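(* Let $\mu>0$ be a real number, let $k\ge 1$ be an integer, and set $\varpi = 2\pi k\,\frac{\sqrt{\mu^2+1}}{\mu}$. For $a=(a_1,\dots,a_6)\in\mathbb{R}^6$ let $$\mathfrak{har}[a] = J_1\!\left(\tfrac{2\pi k r}{\mu}\right)\left(a_1\cos(2\pi kz)+a_2\sin(2\pi kz)\right)dr + r\,J_1\!\left(\tfrac{2\pi kr}{\mu}\right)\left(a_3\cos(2\pi kz)+a_4\sin(2\pi kz)\right)d\phi + J_0\!\left(\tfrac{2\pi kr}{\mu}\right)\left(a_5\cos(2\pi kz)+a_6\sin(2\pi kz)\right)dz .$$ Every $\mathfrak{har}[a]$ satisfies $\Delta\,\mathfrak{har}[a]=-\varpi^2\,\mathfrak{har}[a]$. Moreover, for real parameters define $$\mathfrak{Belt}_+[\alpha_+,\beta_+] = J_1\!\left(\tfrac{2\pi kr}{\mu}\right)(\alpha_+\cos 2\pi kz+\beta_+\sin 2\pi kz)\,dr+\tfrac{\sqrt{\mu^2+1}}{\mu}\, r\,J_1\!\left(\tfrac{2\pi kr}{\mu}\right)(\beta_+\cos 2\pi kz-\alpha_+\sin 2\pi kz)\,d\phi+\tfrac1\mu J_0\!\left(\tfrac{2\pi kr}{\mu}\right)(\beta_+\cos 2\pi kz-\alpha_+\sin 2\pi kz)\,dz,$$ $$\mathfrak{Belt}_-[\alpha_-,\beta_-] = -J_1\!\left(\tfrac{2\pi kr}{\mu}\right)(\alpha_-\cos 2\pi kz-\beta_-\sin 2\pi kz)\,dr-\tfrac{\sqrt{\mu^2+1}}{\mu}\,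 r\,J_1\!\left(\tfrac{2\pi kr}{\mu}\right)(\alpha_-\sin 2\pi kz+\beta_-\cos 2\pi kz)\,d\phi+\tfrac1\mu J_0\!\left(\tfrac{2\pi kr}{\mu}\right)(\alpha_-\sin 2\pi kz+\beta_-\cos 2\pi kz)\,dz,$$ $$\mathfrak{clos}[\alpha_0,\beta_0] = J_1\!\left(\tfrac{2\pi kr}{\mu}\right)(\alpha_0\cos 2\pi kz+\beta_0\sin 2\pi kz)\,dr+\mu\, J_0\!\left(\tfrac{2\pi kr}{\mu}\right)(\alpha_0\sin 2\pi kz-\beta_0\cos 2\pi kz)\,dz .$$ Then $$\star d\,\mathfrak{Belt}_{+}[\alpha_+,\beta_+]=\varpi\,\mathfrak{Belt}_{+}[\alpha_+,\beta_+],\qquad \star d\,\mathfrak{Belt}_{-}[\alpha_-,\beta_-]=-\varpi\,\mathfrak{Belt}_{-}[\alpha_-,\beta_-],\qquad d\,\mathfrak{clos}[\alpha_0,\beta_0]=0,$$ and the six-dimensional space $\mathcal{H}=\{\mathfrak{har}[a] : a\in\mathbb{R}^6\}$ is the direct sum of three two-dimensional subspaces: the space $\{\omega\in\mathcal{H}:\star d\omega=\varpi\omega\}$ of Beltrami forms, the space $\{\omega\in\mathcal{H}:\star d\omega=-\varpi\omega\}$ of anti-Beltrami forms, and the space $\{\omega\in\mathcal{H}:d\omega=0\}$ of closed forms, which consist respectively of the forms $\mathfrak{Belt}_+[\alpha_+,\beta_+]$, $\mathfrak{Belt}_-[\alpha_-,\beta_-]$ and $\mathfrak{clos}[\alpha_0,\beta_0]$.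 Explicitly, $$\mathfrak{har}[a]=\mathfrak{Belt}_+[\alpha_+,\beta_+]+\mathfrak{Belt}_-[\alpha_-,\beta_-]+\mathfrak{clos}[\alpha_0,\beta_0]$$ holds when $$a_1=\alpha_+-\alpha_-+\alpha_0,\quad a_2=\beta_++\beta_-+\beta_0,\quad a_3=\tfrac{\sqrt{\mu^2+1}}{\mu}(\beta_+-\beta_-),\quad a_4=-\tfrac{\sqrt{\mu^2+1}}{\mu}(\alpha_++\alpha_-),$$ $$a_5=\tfrac{1}{\mu}(\beta_++\beta_--\mu^2\beta_0),\quad a_6=\tfrac1\mu(-\alpha_++\alpha_-+\mu^2\alpha_0),$$ and this linear map $(\alpha_+,\beta_+,\alpha_-,\beta_-,\alpha_0,\beta_0)\mapsto(a_1,\dots,a_6)$ is invertible, with inverse $$\alpha_\pm=\pm\tfrac{\mu^2}{2(\mu^2+1)}a_1-\tfrac{\mu}{2\sqrt{\mu^2+1}}a_4\mp\tfrac{\mu}{2(\mu^2+1)}a_6,\qquad \beta_\pm=\tfrac{\mu^2}{2(\mu^2+1)}a_2\pm\tfrac{\mu}{2\sqrt{\mu^2+1}}a_3+\tfrac{\mu}{2(\mu^2+1)}a_5,$$ $$\alpha_0=\tfrac{1}{\mu^2+1}a_1+\tfrac{\mu}{\mu^2+1}a_6,\qquad \beta_0=\tfrac{1}{\mu^2+1}a_2-\tfrac{\mu}{\mu^2+1}a_5 .$$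
   Context: Work on $\{r>0\}\subset\mathbb{R}^3$ in cylindrical coordinates $(r,\phi,z)$, $x=r\cos\phi$, $y=r\sin\phi$, with the flat metric $ds^2=dr^2+r^2d\phi^2+dz^2$ and volume form $\mathrm{Vol}=r\,dr\wedge d\phi\wedge dz$ (orthonormal coframe $dr,\ r\,d\phi,\ dz$, positively oriented). $\star$ is the Hodge star of this metric, so that $\star d$ on $1$-forms is the curl. $J_0,J_1$ are the Bessel functions of the first kind. $\Delta$ is the Laplacian on $1$-forms, with the sign for which it is the usual vector Laplacian $\mathrm{grad}\,\mathrm{div}-\mathrm{curl}\,\mathrm{curl}$ (in Cartesian components, $\sum_i\partial_i^2$ applied to each component), i.e. $\Delta=d\star d\star-\star d\star d$ on $1$-forms. For an axially symmetric $1$-form $\Omega=G(r,z)\,dr+r^2H(r,z)\,d\phi+W(r,z)\,dz$ this reads $$\Delta\Omega=\left(\partial_z^2G+\partial_r^2G+\tfrac1r\partial_rG-\tfrac{1}{r^2}G\right)dr+r^2\left(\partial_z^2H+\partial_r^2H+\tfrac3r\partial_rH\right)d\phi+\left(\partial_z^2W+\partial_r^2W+\tfrac1r\partial_rW\right)dz .$$ A Beltrami (resp. anti-Beltrami) form is an eigenform of $\star d$ with positive (resp. negative) eigenvalue. *)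

theory Defs
  imports "HOL-Analysis.Analysis"
begin

text \<open>
  Bessel functions of the first kind of integer order, by their (everywhere convergent)
  power series.
\<close>

definition bessel_J :: "nat \<Rightarrow> real \<Rightarrow> real" where
  "bessel_J n x = (\<Sum>m. (-1) ^ m / (fact m * fact (m + n)) * (x / 2) ^ (2 * m + n))"


text \<open>
  Real-valued functions on \<open>{r > 0}\<close>, written in cylindrical coordinates \<open>r \<phi> z\<close>:
  they are \<open>2\<pi>\<close>-periodic in \<open>\<phi>\<close>.  The values at \<open>r \<le> 0\<close> lie outside the domain and are
  normalised to 0, so that equality in the type is equality on \<open>{r > 0}\<close>.
\<close>

typedef sfun = "{f :: real \<Rightarrow> real \<Rightarrow> real \<Rightarrow> real.
    (\<forall>r \<phi> z. r \<le> 0 \<longrightarrow> f r \<phi> z = 0) \<and> (\<forall>r \<phi> z. f r (\<phi> + 2 * pi) z = f r \<phi> z)}"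
  morphisms cyl_val Abs_sfun
  by (rule exI[of _ "\<lambda>_ _ _. 0"]) simp

setup_lifting type_definition_sfun

instantiation sfun :: real_vector
begin

lift_definition zero_sfun :: sfun is "\<lambda>r \<phi> z. 0" by simp
lift_definition plus_sfun :: "sfun \<Rightarrow> sfun \<Rightarrow> sfun" is "\<lambda>f g r \<phi> z. f r \<phi> z + g r \<phi> z" by simp
lift_definition minus_sfun :: "sfun \<Rightarrow> sfun \<Rightarrow> sfun" is "\<lambda>f g r \<phi> z. f r \<phi> z - g r \<phi> z" by simp
lift_definition uminus_sfun :: "sfun \<Rightarrow> sfun" is "\<lambda>f r \<phi> z. - f r \<phi> z" by simp
lift_definition scaleR_sfun :: "real \<Rightarrow> sfun \<Rightarrow> sfun" is "\<lambda>c f r \<phi> z. c * f r \<phi> z" by simp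

instance
  by standard (transfer; simp add: fun_eq_iff algebra_simps)+

end

lift_definition partial_r :: "sfun \<Rightarrow> sfun" is
  "\<lambda>f r \<phi> z. if 0 < r then deriv (\<lambda>s. f s \<phi> z) r else 0"
  by auto

lift_definition partial_phi :: "sfun \<Rightarrow> sfun" is
  "\<lambda>f r \<phi> z. deriv (\<lambda>s. f r s z) \<phi>"
proof -
  fix f :: "real \<Rightarrow> real \<Rightarrow> real \<Rightarrow> real"
  assume f: "(\<forall>r \<phi> z. r \<le> 0 \<longrightarrow> f r \<phi> z = 0) \<and> (\<forall>r \<phi> z. f r (\<phi> + 2 * pi) z = f r \<phi> z)"
  have "deriv (\<lambda>s. f r s z) (\<phi> + 2 * pi) = deriv (\<lambda>s. f r s z) \<phi>" for r \<phi> z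
    using f by (simp add: deriv_def DERIV_shift)
  with f show "(\<forall>r \<phi> z. r \<le> 0 \<longrightarrow> deriv (\<lambda>s. f r s z) \<phi> = 0) \<and>
      (\<forall>r \<phi> z. deriv (\<lambda>s. f r s z) (\<phi> + 2 * pi) = deriv (\<lambda>s. f r s z) \<phi>)"
    by simp
qed

lift_definition partial_z :: "sfun \<Rightarrow> sfun" is
  "\<lambda>f r \<phi> z. deriv (\<lambda>s. f r \<phi> s) z"
proof -
  fix f :: "real \<Rightarrow> real \<Rightarrow> real \<Rightarrow> real"
  assume f: "(\<forall>r \<phi> z. r \<le> 0 \<longrightarrow> f r \<phi> z = 0) \<and> (\<forall>r \<phi> z. f r (\<phi> + 2 * pi) z = f r \<phi> z)"
  have "f r \<phi> = (\<lambda>_. 0)" if "r \<le> 0" for r \<phi>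
    using f that by (simp add: fun_eq_iff)
  moreover have "f r (\<phi> + 2 * pi) = f r \<phi>" for r \<phi>
    using f by (simp add: fun_eq_iff)
  ultimately show "(\<forall>r \<phi> z. r \<le> 0 \<longrightarrow> deriv (\<lambda>s. f r \<phi> s) z = 0) \<and>
      (\<forall>r \<phi> z. deriv (\<lambda>s. f r (\<phi> + 2 * pi) s) z = deriv (\<lambda>s. f r \<phi> s) z)"
    by simp
qed

lift_definition mult_r :: "sfun \<Rightarrow> sfun" is "\<lambda>f r \<phi> z. r * f r \<phi> z" by simp
lift_definition div_r :: "sfun \<Rightarrow> sfun" is "\<lambda>f r \<phi> z. f r \<phi> z / r" by simp

lift_definition axisym :: "(real \<Rightarrow> real \<Rightarrow> real) \<Rightarrow> sfun" is
  "\<lambda>g r \<phi> z. if 0 < r then g r z else 0"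
  by auto


text \<open>
  Differential forms on \<open>{r > 0}\<close>, given by their coefficients with respect to
  \<open>dr, d\<phi>, dz\<close> (1-forms), \<open>d\<phi>\<and>dz, dz\<and>dr, dr\<and>d\<phi>\<close> (2-forms) and \<open>dr\<and>d\<phi>\<and>dz\<close> (3-forms).
\<close>

type_synonym form0 = sfun
type_synonym form1 = "sfun \<times> sfun \<times> sfun"
type_synonym form2 = "sfun \<times> sfun \<times> sfun"
type_synonym form3 = sfun

definition ext_d0 :: "form0 \<Rightarrow> form1" where
  "ext_d0 f = (partial_r f, partial_phi f, partial_z f)"

definition ext_d1 :: "form1 \<Rightarrow> form2" where
  "ext_d1 = (\<lambda>(A, B, C).
     (partial_phi C - partial_z B, partial_z A - partial_r C, partial_r B - partial_phi A))"

definition ext_d2 :: "form2 \<Rightarrow> form3" where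
  "ext_d2 = (\<lambda>(P, Q, R). partial_r P + partial_phi Q + partial_z R)"

text \<open>
  The Hodge star of the flat metric.  In the oriented orthonormal coframe \<open>e1 = dr\<close>,
  \<open>e2 = r d\<phi>\<close>, \<open>e3 = dz\<close> it is \<open>e1 \<leftrightarrow> e2\<and>e3\<close>, \<open>e2 \<leftrightarrow> e3\<and>e1\<close>, \<open>e3 \<leftrightarrow> e1\<and>e2\<close>,
  \<open>1 \<leftrightarrow> e1\<and>e2\<and>e3\<close>; the powers of \<open>r\<close> come from rewriting this in terms of \<open>dr, d\<phi>, dz\<close>.
\<close>

definition star1 :: "form1 \<Rightarrow> form2" where
  "star1 = (\<lambda>(A, B, C). (mult_r A, div_r B, mult_r C))"

definition star2 :: "form2 \<Rightarrow> form1" where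
  "star2 = (\<lambda>(P, Q, R). (div_r P, mult_r Q, div_r R))"

definition star3 :: "form3 \<Rightarrow> form0" where
  "star3 T = div_r T"

definition star_d :: "form1 \<Rightarrow> form1" where
  "star_d \<omega> = star2 (ext_d1 \<omega>)"

definition laplacian1 :: "form1 \<Rightarrow> form1" where
  "laplacian1 \<omega> = ext_d0 (star3 (ext_d2 (star1 \<omega>))) - star2 (ext_d1 (star2 (ext_d1 \<omega>)))"


definition varpi :: "real \<Rightarrow> nat \<Rightarrow> real" where
  "varpi \<mu> k = 2 * pi * real k * (sqrt (\<mu>\<^sup>2 + 1) / \<mu>)"

type_synonym real6 = "real \<times> real \<times> real \<times> real \<times> real \<times> real"

definition har :: "real \<Rightarrow> nat \<Rightarrow> real6 \<Rightarrow> form1" where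
  "har \<mu> k = (\<lambda>(a1, a2, a3, a4, a5, a6).
    (axisym (\<lambda>r z. bessel_J 1 (2 * pi * k * r / \<mu>)
        * (a1 * cos (2 * pi * k * z) + a2 * sin (2 * pi * k * z))),
     axisym (\<lambda>r z. r * bessel_J 1 (2 * pi * k * r / \<mu>)
        * (a3 * cos (2 * pi * k * z) + a4 * sin (2 * pi * k * z))),
     axisym (\<lambda>r z. bessel_J 0 (2 * pi * k * r / \<mu>)
        * (a5 * cos (2 * pi * k * z) + a6 * sin (2 * pi * k * z)))))"

definition Belt_plus :: "real \<Rightarrow> nat \<Rightarrow> real \<Rightarrow> real \<Rightarrow> form1" where
  "Belt_plus \<mu> k \<alpha> \<beta> =
    (axisym (\<lambda>r z. bessel_J 1 (2 * pi * k * r / \<mu>)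
        * (\<alpha> * cos (2 * pi * k * z) + \<beta> * sin (2 * pi * k * z))),
     axisym (\<lambda>r z. sqrt (\<mu>\<^sup>2 + 1) / \<mu> * r * bessel_J 1 (2 * pi * k * r / \<mu>)
        * (\<beta> * cos (2 * pi * k * z) - \<alpha> * sin (2 * pi * k * z))),
     axisym (\<lambda>r z. 1 / \<mu> * bessel_J 0 (2 * pi * k * r / \<mu>)
        * (\<beta> * cos (2 * pi * k * z) - \<alpha> * sin (2 * pi * k * z))))"

definition Belt_minus :: "real \<Rightarrow> nat \<Rightarrow> real \<Rightarrow> real \<Rightarrow> form1" where
  "Belt_minus \<mu> k \<alpha> \<beta> =
    (axisym (\<lambda>r z. - bessel_J 1 (2 * pi * k * r / \<mu>)
        * (\<alpha> * cos (2 * pi * k * z) - \<beta> * sin (2 * pi * k * z))),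
     axisym (\<lambda>r z. - (sqrt (\<mu>\<^sup>2 + 1) / \<mu>) * r * bessel_J 1 (2 * pi * k * r / \<mu>)
        * (\<alpha> * sin (2 * pi * k * z) + \<beta> * cos (2 * pi * k * z))),
     axisym (\<lambda>r z. 1 / \<mu> * bessel_J 0 (2 * pi * k * r / \<mu>)
        * (\<alpha> * sin (2 * pi * k * z) + \<beta> * cos (2 * pi * k * z))))"

definition clos :: "real \<Rightarrow> nat \<Rightarrow> real \<Rightarrow> real \<Rightarrow> form1" where
  "clos \<mu> k \<alpha> \<beta> =
    (axisym (\<lambda>r z. bessel_J 1 (2 * pi * k * r / \<mu>)
        * (\<alpha> * cos (2 * pi * k * z) + \<beta> * sin (2 * pi * k * z))),
     0,
     axisym (\<lambda>r z. \<mu> * bessel_J 0 (2 * pi * k * r / \<mu>)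
        * (\<alpha> * sin (2 * pi * k * z) - \<beta> * cos (2 * pi * k * z))))"

definition Harm :: "real \<Rightarrow> nat \<Rightarrow> form1 set" where
  "Harm \<mu> k = range (har \<mu> k)"

definition Beltrami_space :: "real \<Rightarrow> nat \<Rightarrow> form1 set" where
  "Beltrami_space \<mu> k = {\<omega> \<in> Harm \<mu> k. star_d \<omega> = varpi \<mu> k *\<^sub>R \<omega>}"

definition anti_Beltrami_space :: "real \<Rightarrow> nat \<Rightarrow> form1 set" where
  "anti_Beltrami_space \<mu> k = {\<omega> \<in> Harm \<mu> k. star_d \<omega> = (- varpi \<mu> k) *\<^sub>R \<omega>}"

definition closed_space :: "real \<Rightarrow> nat \<Rightarrow> form1 set" where
  "closed_space \<mu> k = {\<omega> \<in> Harm \<mu> k. ext_d1 \<omega> = 0}"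

definition is_direct_sum3 ::
    "'a::real_vector set \<Rightarrow> 'a set \<Rightarrow> 'a set \<Rightarrow> 'a set \<Rightarrow> bool" where
  "is_direct_sum3 V A B C \<longleftrightarrow>
     subspace V \<and> subspace A \<and> subspace B \<and> subspace C \<and>
     bij_betw (\<lambda>(a, b, c). a + b + c) (A \<times> B \<times> C) V"

text \<open>
  Parameters are ordered \<open>(\<alpha>\<^sub>+, \<beta>\<^sub>+, \<alpha>\<^sub>-, \<beta>\<^sub>-, \<alpha>\<^sub>0, \<beta>\<^sub>0)\<close>; the letters \<open>p, m, 0\<close> stand for
  the subscripts.
\<close>

definition param_map :: "real \<Rightarrow> real6 \<Rightarrow> real6" where
  "param_map \<mu> = (\<lambda>(\<alpha>p, \<beta>p, \<alpha>m, \<beta>m, \<alpha>0, \<beta>0).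
    (\<alpha>p - \<alpha>m + \<alpha>0,
     \<beta>p + \<beta>m + \<beta>0,
     sqrt (\<mu>\<^sup>2 + 1) / \<mu> * (\<beta>p - \<beta>m),
     - (sqrt (\<mu>\<^sup>2 + 1) / \<mu>) * (\<alpha>p + \<alpha>m),
     1 / \<mu> * (\<beta>p + \<beta>m - \<mu>\<^sup>2 * \<beta>0),
     1 / \<mu> * (- \<alpha>p + \<alpha>m + \<mu>\<^sup>2 * \<alpha>0)))"

definition param_inv :: "real \<Rightarrow> real6 \<Rightarrow> real6" where
  "param_inv \<mu> = (\<lambda>(a1, a2, a3, a4, a5, a6).
    (\<mu>\<^sup>2 / (2 * (\<mu>\<^sup>2 + 1)) * a1 - \<mu> / (2 * sqrt (\<mu>\<^sup>2 + 1)) * a4 - \<mu> / (2 * (\<mu>\<^sup>2 + 1)) * a6,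
     \<mu>\<^sup>2 / (2 * (\<mu>\<^sup>2 + 1)) * a2 + \<mu> / (2 * sqrt (\<mu>\<^sup>2 + 1)) * a3 + \<mu> / (2 * (\<mu>\<^sup>2 + 1)) * a5,
     - (\<mu>\<^sup>2 / (2 * (\<mu>\<^sup>2 + 1))) * a1 - \<mu> / (2 * sqrt (\<mu>\<^sup>2 + 1)) * a4 + \<mu> / (2 * (\<mu>\<^sup>2 + 1)) * a6,
     \<mu>\<^sup>2 / (2 * (\<mu>\<^sup>2 + 1)) * a2 - \<mu> / (2 * sqrt (\<mu>\<^sup>2 + 1)) * a3 + \<mu> / (2 * (\<mu>\<^sup>2 + 1)) * a5,
     1 / (\<mu>\<^sup>2 + 1) * a1 + \<mu> / (\<mu>\<^sup>2 + 1) * a6,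
     1 / (\<mu>\<^sup>2 + 1) * a2 - \<mu> / (\<mu>\<^sup>2 + 1) * a5))"

end

(*
The relations J_0' = -J_1 and (x J_1)' = x J_0 show that curl and grad div act on har[a] by
linear maps of the coefficient vector a, and har is injective because neither J_0 nor J_1
vanishes identically on the positive half-line.  In the parameters of param_map the curl is
diag(w, w, -w, -w, 0, 0) with w = varpi, so the three eigenspaces are read off; a form is
closed iff its curl vanishes, the Hodge star being injective.
*)

theory Submission
  imports Defs
begin

section \<open>Bessel functions\<close>

definition bessel_coeff :: "nat \<Rightarrow> nat \<Rightarrow> real" where
  "bessel_coeff n m = (-1) ^ m / (fact m * fact (m + n))"

text \<open>The entire factor in J_n(x) = (x/2)^n E_n((x/2)^2). Splitting off the monomial leaves an
  ordinary power series in y, so termwise differentiation applies directly and only shifts the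
  index.\<close>

definition bessel_E :: "nat \<Rightarrow> real \<Rightarrow> real" where
  "bessel_E n y = (\<Sum>m. bessel_coeff n m * y ^ m)"

lemma summable_bessel_E: "summable (\<lambda>m. bessel_coeff n m * y ^ m)"
proof (rule summable_comparison_test')
  show "summable (\<lambda>m. inverse (fact m) * \<bar>y\<bar> ^ m)"
    by (rule summable_exp)
  show "norm (bessel_coeff n m * y ^ m) \<le> inverse (fact m) * \<bar>y\<bar> ^ m" for m
  proof -
    have "inverse (fact (m + n)) \<le> (1::real)"
      by (simp add: inverse_le_1_iff)
    then have "inverse (fact m) * \<bar>y\<bar> ^ m * inverse (fact (m + n)) \<le> inverse (fact m) * \<bar>y\<bar> ^ m * 1"
      by (intro mult_left_mono) auto
    then show ?thesis
      by (simp add: bessel_coeff_def abs_mult power_abs field_simps)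
  qed
qed

lemma bessel_J_eq_bessel_E: "bessel_J n x = (x / 2) ^ n * bessel_E n ((x / 2)\<^sup>2)"
proof -
  have "bessel_J n x = (\<Sum>m. (x / 2) ^ n * (bessel_coeff n m * ((x / 2)\<^sup>2) ^ m))"
    unfolding bessel_J_def
    by (intro suminf_cong) (simp add: bessel_coeff_def power_add power_mult)
  also have "\<dots> = (x / 2) ^ n * bessel_E n ((x / 2)\<^sup>2)"
    unfolding bessel_E_def by (rule suminf_mult[OF summable_bessel_E])
  finally show ?thesis .
qed

text \<open>Termwise differentiation: (m+1) times coefficient m+1 of E_n is minus coefficient m of
  E_(n+1).\<close>

lemma DERIV_bessel_E [derivative_intros]:
  assumes "(g has_real_derivative g') (at x within A)"
  shows "((\<lambda>x. bessel_E n (g x)) has_real_derivative - bessel_E (Suc n) (g x) * g') (at x within A)"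
proof -
  have diffs: "diffs (bessel_coeff n) m = - bessel_coeff (Suc n) m" for m
    unfolding diffs_def bessel_coeff_def by (simp add: divide_simps del: of_nat_Suc)
  have "(bessel_E n has_real_derivative - bessel_E (Suc n) y) (at y)" for y
  proof -
    have "DERIV (\<lambda>y. \<Sum>m. bessel_coeff n m * y ^ m) y
        :> (\<Sum>m. diffs (bessel_coeff n) m * y ^ m)"
      by (rule termdiffs_strong_converges_everywhere[OF summable_bessel_E])
    then show ?thesis
      by (simp add: bessel_E_def[abs_def] diffs suminf_minus[OF summable_bessel_E])
  qed
  from DERIV_chain2[OF this assms] show ?thesis .
qed

text \<open>This is J_n + J_(n+2) = (2(n+1)/x) J_(n+1) with the powers of x/2 cancelled. The case n
  = 0 yields (x J_1)' = x J_0.\<close>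

lemma bessel_E_recurrence:
  "bessel_E n y = real (Suc n) * bessel_E (Suc n) y - y * bessel_E (Suc (Suc n)) y"
proof -
  \<comment> \<open>\<open>f\<close> lists the terms of (n+1) E_(n+1) - E_n. Its zeroth term
    vanishes, and the remaining terms, shifted by one, are those of y E_(n+2).\<close>
  define f where "f m = (real (Suc n) * bessel_coeff (Suc n) m - bessel_coeff n m) * y ^ m" for m
  have sums: "(\<lambda>m. bessel_coeff i m * y ^ m) sums bessel_E i y" for i
    unfolding bessel_E_def by (rule summable_sums[OF summable_bessel_E])
  have "(\<lambda>m. real (Suc n) * (bessel_coeff (Suc n) m * y ^ m) - bessel_coeff n m * y ^ m)
      sums (real (Suc n) * bessel_E (Suc n) y - bessel_E n y)"
    by (intro sums_diff sums_mult sums)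
  then have 1: "f sums (real (Suc n) * bessel_E (Suc n) y - bessel_E n y)"
    by (simp add: f_def[abs_def] algebra_simps)
  have "real (Suc n) * bessel_coeff (Suc n) (Suc m) - bessel_coeff n (Suc m)
      = bessel_coeff (Suc (Suc n)) m" for m
    unfolding bessel_coeff_def
    by (simp add: divide_simps del: of_nat_Suc) (simp add: algebra_simps)
  then have "f (Suc m) = y * (bessel_coeff (Suc (Suc n)) m * y ^ m)" for m
    by (simp add: f_def del: of_nat_Suc)
  then have "(\<lambda>m. f (Suc m)) sums (y * bessel_E (Suc (Suc n)) y)"
    using sums_mult[OF sums] by simp
  then have "f sums (y * bessel_E (Suc (Suc n)) y + f 0)"
    by (rule sums_Suc)
  moreover have "f 0 = 0"
    by (simp add: f_def bessel_coeff_def divide_simps del: of_nat_Suc)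
  ultimately show ?thesis
    using sums_unique2[OF 1, of "y * bessel_E (Suc (Suc n)) y"] by simp
qed

lemma DERIV_bessel_J_0 [derivative_intros]:
  assumes "(g has_real_derivative g') (at x within A)"
  shows "((\<lambda>x. bessel_J 0 (g x)) has_real_derivative - bessel_J 1 (g x) * g') (at x within A)"
proof -
  have "(bessel_J 0 has_real_derivative - bessel_J 1 x) (at x)" for x
    unfolding bessel_J_eq_bessel_E[abs_def]
    by (auto intro!: derivative_eq_intros simp: power2_eq_square)
  from DERIV_chain2[OF this assms] show ?thesis .
qed

text \<open>With y = (x/2)^2, the function x J_1(x) = 2 y E_1(y) has derivative x (E_1(y) - y
  E_2(y)), and the recurrence turns the bracket into E_0(y). The weight x avoids dividing by
  x.\<close>

lemma DERIV_bessel_J_1_weighted: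
  "((\<lambda>x. x * bessel_J 1 x) has_real_derivative x * bessel_J 0 x) (at x)"
  unfolding bessel_J_eq_bessel_E[abs_def] bessel_E_recurrence[of 0]
  by (auto intro!: derivative_eq_intros
      simp: power2_eq_square algebra_simps add_divide_distrib diff_divide_distrib)

text \<open>J_0(0) = 1, but forms only see r > 0, so continuity is used to move to a positive
  argument.\<close>

lemma bessel_J_0_nonzero: "\<exists>x>0. bessel_J 0 x \<noteq> 0"
proof -
  have "bessel_E 0 0 = 1"
    using powser_zero[of "bessel_coeff 0"] by (simp add: bessel_E_def bessel_coeff_def)
  then have "bessel_J 0 0 \<noteq> 0"
    by (simp add: bessel_J_eq_bessel_E)
  moreover have "isCont (bessel_J 0) 0"
    using DERIV_bessel_J_0[OF DERIV_ident] DERIV_isCont by blast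
  ultimately obtain e where "e > 0" "\<forall>x. dist 0 x < e \<longrightarrow> bessel_J 0 x \<noteq> 0"
    using continuous_at_avoid by blast
  then show ?thesis
    by (intro exI[of _ "e / 2"]) (auto simp: dist_real_def)
qed

text \<open>If J_1 vanished on the positive half-line, so would x J_0, the derivative of x
  J_1.\<close>

lemma bessel_J_1_nonzero: "\<exists>x>0. bessel_J 1 x \<noteq> 0"
proof (rule ccontr)
  assume "\<not> ?thesis"
  then have zero: "x * bessel_J 1 x = 0" if "x > 0" for x
    using that by auto
  obtain x where x: "x > 0" "bessel_J 0 x \<noteq> 0"
    using bessel_J_0_nonzero by blast
  have "((\<lambda>_. 0) has_real_derivative x * bessel_J 0 x) (at x)"
    by (rule has_field_derivative_transform_within_open[OF DERIV_bessel_J_1_weighted, where S = "{0<..}"])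
      (use x zero in auto)
  then have "x * bessel_J 0 x = 0"
    by (rule DERIV_unique) simp
  with x show False by simp
qed

section \<open>Axially symmetric forms\<close>

lemma axisym_cong: "(\<And>r z. r > 0 \<Longrightarrow> g r z = h r z) \<Longrightarrow> axisym g = axisym h"
  by transfer (auto simp: fun_eq_iff)

lemma axisym_eqD: "axisym g = axisym h \<Longrightarrow> r > 0 \<Longrightarrow> g r z = h r z"
  by transfer metis

lemma axisym_zero: "axisym (\<lambda>_ _. 0) = 0"
  by transfer (simp add: fun_eq_iff)

lemma axisym_add: "axisym g + axisym h = axisym (\<lambda>r z. g r z + h r z)"
  by transfer (simp add: fun_eq_iff)

lemma axisym_diff: "axisym g - axisym h = axisym (\<lambda>r z. g r z - h r z)"
  by transfer (simp add: fun_eq_iff)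

lemma axisym_scaleR: "c *\<^sub>R axisym g = axisym (\<lambda>r z. c * g r z)"
  by transfer (simp add: fun_eq_iff)

lemma mult_r_axisym: "mult_r (axisym g) = axisym (\<lambda>r z. r * g r z)"
  by transfer (simp add: fun_eq_iff)

lemma div_r_axisym: "div_r (axisym g) = axisym (\<lambda>r z. g r z / r)"
  by transfer (simp add: fun_eq_iff)

lemma partial_phi_axisym: "partial_phi (axisym g) = 0"
  by transfer (simp add: fun_eq_iff)

lemma partial_z_axisym:
  assumes "\<And>r z. r > 0 \<Longrightarrow> (g r has_real_derivative h r z) (at z)"
  shows "partial_z (axisym g) = axisym h"
  using assms by transfer (auto simp: fun_eq_iff intro!: DERIV_imp_deriv)

text \<open>A point r > 0 is interior to the half-line, so the cutoff built into
  \<open>axisym\<close> does not affect the derivative there.\<close>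

lemma partial_r_axisym:
  assumes "\<And>r z. r > 0 \<Longrightarrow> ((\<lambda>s. g s z) has_real_derivative h r z) (at r)"
  shows "partial_r (axisym g) = axisym h"
  using assms
proof transfer
  fix g h :: "real \<Rightarrow> real \<Rightarrow> real"
  assume *: "\<And>r z. r > 0 \<Longrightarrow> ((\<lambda>s. g s z) has_real_derivative h r z) (at r)"
  have "((\<lambda>s. if 0 < s then g s z else 0) has_real_derivative h r z) (at r)" if "r > 0" for r z
    by (rule has_field_derivative_transform_within_open[OF *[OF that], where S = "{0<..}"])
      (use that in auto)
  then show "(\<lambda>r \<phi> z. if 0 < r then deriv (\<lambda>s. if 0 < s then g s z else 0) r else 0) =
      (\<lambda>r \<phi> z. if 0 < r then h r z else 0)"
    by (auto simp: fun_eq_iff intro!: DERIV_imp_deriv)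
qed

text \<open>For r > 0 the factor 1/r is nonzero; for r \<le> 0 the normalisation already forces the
  value 0.\<close>

lemma div_r_eq_0_iff: "div_r f = 0 \<longleftrightarrow> f = 0"
  by transfer (simp add: fun_eq_iff, metis order_refl)

lemma mult_r_eq_0_iff: "mult_r f = 0 \<longleftrightarrow> f = 0"
  by transfer (simp add: fun_eq_iff, metis order_refl)

lemma star_d_eq_0_iff: "star_d \<omega> = 0 \<longleftrightarrow> ext_d1 \<omega> = 0"
  by (cases "ext_d1 \<omega>")
    (simp add: star_d_def star2_def zero_prod_def div_r_eq_0_iff mult_r_eq_0_iff)

text \<open>In the application, \<open>\<kappa> = 2\<pi>k\<close> and \<open>q = \<kappa>/\<mu>\<close>.\<close>

lemma partial_z_axisym_harmonic:
  "partial_z (axisym (\<lambda>r z. f r * (a * cos (\<kappa> * z) + b * sin (\<kappa> * z))))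
    = axisym (\<lambda>r z. f r * (\<kappa> * b * cos (\<kappa> * z) - \<kappa> * a * sin (\<kappa> * z)))"
  by (rule partial_z_axisym) (auto intro!: derivative_eq_intros simp: algebra_simps)

lemma partial_r_axisym_bessel_J_0:
  "partial_r (axisym (\<lambda>r z. bessel_J 0 (q * r) * g z))
    = axisym (\<lambda>r z. - q * bessel_J 1 (q * r) * g z)"
  by (rule partial_r_axisym) (auto intro!: derivative_eq_intros)

lemma partial_r_axisym_bessel_J_1:
  assumes "q \<noteq> 0"
  shows "partial_r (axisym (\<lambda>r z. r * bessel_J 1 (q * r) * g z))
    = axisym (\<lambda>r z. q * r * bessel_J 0 (q * r) * g z)"
proof (rule partial_r_axisym)
  fix r z :: real
  \<comment> \<open>Inserting q / q exhibits x J_1(x) at x = q s, the form to which the weighted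
    derivative applies.\<close>
  have "((\<lambda>s. (q * s * bessel_J 1 (q * s)) * (g z / q)) has_real_derivative
      (q * r * bessel_J 0 (q * r) * q) * (g z / q)) (at r)"
    by (rule DERIV_cmult_right, rule DERIV_chain2[OF DERIV_bessel_J_1_weighted])
      (auto intro!: derivative_eq_intros)
  then show "((\<lambda>s. s * bessel_J 1 (q * s) * g z) has_real_derivative
      q * r * bessel_J 0 (q * r) * g z) (at r)"
    using assms by (simp add: mult_ac)
qed

section \<open>Curl and divergence on the six-dimensional space\<close>

text \<open>The matrix of the curl on coefficient vectors. A z-derivative exchanges cosine and sine
  with a factor \<kappa>, an r-derivative exchanges J_0 and J_1 with a factor \<kappa>/\<mu>, so the
  six-dimensional space is preserved.\<close>

definition curl_coeff :: "real \<Rightarrow> nat \<Rightarrow> real6 \<Rightarrow> real6" where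
  "curl_coeff \<mu> k = (\<lambda>(a1, a2, a3, a4, a5, a6). let \<kappa> = 2 * pi * real k in
    (- \<kappa> * a4, \<kappa> * a3, \<kappa> * (a2 + a5 / \<mu>), \<kappa> * (a6 / \<mu> - a1), \<kappa> / \<mu> * a3, \<kappa> / \<mu> * a4))"

text \<open>The matrix of grad div. The middle entries are 0 because the divergence does not depend
  on \<phi>.\<close>

definition grad_div_coeff :: "real \<Rightarrow> nat \<Rightarrow> real6 \<Rightarrow> real6" where
  "grad_div_coeff \<mu> k = (\<lambda>(a1, a2, a3, a4, a5, a6). let \<kappa> = 2 * pi * real k in
    (- \<kappa>\<^sup>2 / \<mu> * (a1 / \<mu> + a6), - \<kappa>\<^sup>2 / \<mu> * (a2 / \<mu> - a5), 0, 0,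
     \<kappa>\<^sup>2 * (a2 / \<mu> - a5), - \<kappa>\<^sup>2 * (a1 / \<mu> + a6)))"

lemma har_alt:
  "har \<mu> k (a1, a2, a3, a4, a5, a6) = (let \<kappa> = 2 * pi * real k; q = \<kappa> / \<mu> in
    (axisym (\<lambda>r z. bessel_J 1 (q * r) * (a1 * cos (\<kappa> * z) + a2 * sin (\<kappa> * z))),
     axisym (\<lambda>r z. r * bessel_J 1 (q * r) * (a3 * cos (\<kappa> * z) + a4 * sin (\<kappa> * z))),
     axisym (\<lambda>r z. bessel_J 0 (q * r) * (a5 * cos (\<kappa> * z) + a6 * sin (\<kappa> * z)))))"
  by (simp add: har_def Let_def)

lemma star_d_har:
  assumes "\<mu> \<noteq> 0" "k > 0"
  shows "star_d (har \<mu> k a) = har \<mu> k (curl_coeff \<mu> k a)"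
proof -
  obtain a1 a2 a3 a4 a5 a6 where a: "a = (a1, a2, a3, a4, a5, a6)"
    by (metis prod.exhaust)
  define \<kappa> where "\<kappa> = 2 * pi * real k"
  define q where "q = \<kappa> / \<mu>"
  have q: "q \<noteq> 0" "\<kappa> = \<mu> * q"
    using assms by (simp_all add: q_def \<kappa>_def)
  show ?thesis
    unfolding a curl_coeff_def star_d_def ext_d1_def star2_def har_alt Let_def prod.case
      \<kappa>_def[symmetric] q_def[symmetric]
      partial_z_axisym_harmonic partial_r_axisym_bessel_J_0 partial_phi_axisym
      partial_r_axisym_bessel_J_1[OF q(1)]
    \<comment> \<open>Each component is collected into a single \<open>axisym\<close>, which leaves
      pointwise identities for r > 0.\<close>
    unfolding diff_0_right diff_0 axisym_zero[symmetric] axisym_diff mult_r_axisym div_r_axisym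
    by (intro arg_cong2[where f = Pair] axisym_cong)
      (use assms q in \<open>simp_all add: field_simps\<close>)
qed

lemma grad_div_har:
  assumes "\<mu> \<noteq> 0" "k > 0"
  shows "ext_d0 (star3 (ext_d2 (star1 (har \<mu> k a)))) = har \<mu> k (grad_div_coeff \<mu> k a)"
proof -
  obtain a1 a2 a3 a4 a5 a6 where a: "a = (a1, a2, a3, a4, a5, a6)"
    by (metis prod.exhaust)
  define \<kappa> where "\<kappa> = 2 * pi * real k"
  define q where "q = \<kappa> / \<mu>"
  have q: "q \<noteq> 0" "\<kappa> = \<mu> * q"
    using assms by (simp_all add: q_def \<kappa>_def)
  \<comment> \<open>The divergence has the shape of the dz component of \<open>har\<close>, so the
    same derivative rules compute its gradient.\<close>
  have div: "star3 (ext_d2 (star1 (har \<mu> k a))) = axisym (\<lambda>r z. bessel_J 0 (q * r)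
      * ((q * a1 + \<kappa> * a6) * cos (\<kappa> * z) + (q * a2 - \<kappa> * a5) * sin (\<kappa> * z)))"
    unfolding a star1_def star3_def ext_d2_def har_alt Let_def prod.case
      \<kappa>_def[symmetric] q_def[symmetric] mult_r_axisym div_r_axisym partial_phi_axisym
      mult.assoc[symmetric]
      partial_z_axisym_harmonic partial_r_axisym_bessel_J_1[OF q(1)]
    unfolding add_0_right axisym_add div_r_axisym
    by (intro axisym_cong) (simp add: field_simps)
  show ?thesis
    unfolding div ext_d0_def
    unfolding a grad_div_coeff_def har_alt Let_def prod.case \<kappa>_def[symmetric] q_def[symmetric]
      partial_r_axisym_bessel_J_0 partial_z_axisym_harmonic partial_phi_axisym axisym_zero[symmetric]
    by (intro arg_cong2[where f = Pair] axisym_cong)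
      (use assms q in \<open>simp_all add: field_simps power2_eq_square\<close>)
qed

section \<open>Linearity and injectivity of the parametrisation by coefficients\<close>

lemma linear_har: "linear (har \<mu> k)"
proof (rule linearI)
  show "har \<mu> k (a + b) = har \<mu> k a + har \<mu> k b" for a b
    by (cases a, cases b)
      (auto simp: har_def axisym_add algebra_simps intro!: axisym_cong)
  show "har \<mu> k (c *\<^sub>R a) = c *\<^sub>R har \<mu> k a" for c a
    by (cases a)
      (auto simp: har_def axisym_scaleR algebra_simps intro!: axisym_cong)
qed

lemma axisym_harmonic_eq_0D:
  assumes "axisym (\<lambda>r z. f r * (a * cos (\<kappa> * z) + b * sin (\<kappa> * z))) = 0"
    and "r > 0" "f r \<noteq> 0" "\<kappa> \<noteq> 0"
  shows "a = 0 \<and> b = 0"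
proof -
  have *: "f r * (a * cos (\<kappa> * z) + b * sin (\<kappa> * z)) = 0" for z
    using axisym_eqD[OF assms(1)[folded axisym_zero] assms(2)] .
  show ?thesis
    \<comment> \<open>At z = 0 only a survives; at a quarter period the cosine vanishes and only b
      survives.\<close>
    using *[of 0] *[of "pi / 2 / \<kappa>"] assms by simp
qed

lemma inj_har:
  assumes "\<mu> > 0" "k > 0"
  shows "inj (har \<mu> k)"
  unfolding linear_injective_0[OF linear_har]
proof (intro allI impI)
  fix a assume "har \<mu> k a = 0"
  obtain a1 a2 a3 a4 a5 a6 where a: "a = (a1, a2, a3, a4, a5, a6)"
    by (metis prod.exhaust)
  define \<kappa> where "\<kappa> = 2 * pi * real k"
  define q where "q = \<kappa> / \<mu>"
  have pos: "\<kappa> \<noteq> 0" "q > 0"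
    using assms by (simp_all add: q_def \<kappa>_def)
  obtain x0 x1 where x: "x0 > 0" "bessel_J 0 x0 \<noteq> 0" "x1 > 0" "bessel_J 1 x1 \<noteq> 0"
    using bessel_J_0_nonzero bessel_J_1_nonzero by blast
  \<comment> \<open>At these radii the Bessel argument q r hits a point where J_0, respectively J_1,
    is nonzero, so one radius per component suffices.\<close>
  have r: "x0 / q > 0" "bessel_J 0 (q * (x0 / q)) \<noteq> 0"
     "x1 / q > 0" "bessel_J 1 (q * (x1 / q)) \<noteq> 0" "x1 / q * bessel_J 1 (q * (x1 / q)) \<noteq> 0"
    using x pos by simp_all
  have "axisym (\<lambda>r z. bessel_J 1 (q * r) * (a1 * cos (\<kappa> * z) + a2 * sin (\<kappa> * z))) = 0"
    "axisym (\<lambda>r z. r * bessel_J 1 (q * r) * (a3 * cos (\<kappa> * z) + a4 * sin (\<kappa> * z))) = 0"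
    "axisym (\<lambda>r z. bessel_J 0 (q * r) * (a5 * cos (\<kappa> * z) + a6 * sin (\<kappa> * z))) = 0"
    using \<open>har \<mu> k a = 0\<close> unfolding a har_alt Let_def zero_prod_def \<kappa>_def q_def by simp_all
  from axisym_harmonic_eq_0D[OF this(1) r(3,4) pos(1)]
    axisym_harmonic_eq_0D[OF this(2) r(3,5) pos(1)]
    axisym_harmonic_eq_0D[OF this(3) r(1,2) pos(1)]
  show "a = 0"
    by (simp add: a zero_prod_def)
qed

text \<open>With \<Delta> = grad div - curl curl, the claim becomes an identity of coefficient
  vectors, settled by \<open>varpi\<close>^2 = \<kappa>^2 (1 + 1/\<mu>^2).\<close>

lemma laplacian1_har:
  assumes "\<mu> > 0" "k > 0"
  shows "laplacian1 (har \<mu> k a) = (- (varpi \<mu> k)\<^sup>2) *\<^sub>R har \<mu> k a"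
proof -
  have "laplacian1 (har \<mu> k a) = har \<mu> k (grad_div_coeff \<mu> k a)
      - har \<mu> k (curl_coeff \<mu> k (curl_coeff \<mu> k a))"
    using assms star_d_har[of \<mu> k] by (simp add: laplacian1_def grad_div_har flip: star_d_def)
  also have "\<dots> = har \<mu> k (grad_div_coeff \<mu> k a - curl_coeff \<mu> k (curl_coeff \<mu> k a))"
    by (simp add: linear_diff[OF linear_har])
  also have "grad_div_coeff \<mu> k a - curl_coeff \<mu> k (curl_coeff \<mu> k a) = (- (varpi \<mu> k)\<^sup>2) *\<^sub>R a"
  proof -
    have "(varpi \<mu> k)\<^sup>2 = (2 * pi * real k)\<^sup>2 * (1 + 1 / \<mu>\<^sup>2)"
      using assms by (simp add: varpi_def power_mult_distrib power_divide field_simps)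
    then show ?thesis
      using assms by (cases a)
        (simp add: curl_coeff_def grad_div_coeff_def Let_def power2_eq_square field_simps)
  qed
  finally show ?thesis
    by (simp only: linear_scale[OF linear_har])
qed

section \<open>Eigenforms of the curl\<close>

lemma linear_param_map: "linear (param_map \<mu>)"
  by (rule linearI) (auto simp: param_map_def algebra_simps add_divide_distrib diff_divide_distrib)

lemma param_map_inverse:
  assumes "\<mu> > 0"
  shows "param_inv \<mu> (param_map \<mu> p) = p" "param_map \<mu> (param_inv \<mu> a) = a"
proof -
  define s where "s = sqrt (\<mu>\<^sup>2 + 1)"
  \<comment> \<open>Writing \<mu>^2 + 1 as s^2 makes all denominators monomials in s and \<mu>; once
    they are cleared, s * s is expanded back.\<close>
  have s: "s > 0" "\<mu>\<^sup>2 + 1 = s\<^sup>2" "s * s = \<mu> * \<mu> + 1"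
    using assms by (simp_all add: s_def add_nonneg_pos flip: power2_eq_square)
  show "param_inv \<mu> (param_map \<mu> p) = p"
    using assms s(1) unfolding param_map_def param_inv_def s_def[symmetric] s(2)
    by (cases p) (simp add: divide_simps, simp add: power2_eq_square s(3) algebra_simps)
  show "param_map \<mu> (param_inv \<mu> a) = a"
    using assms s(1) unfolding param_map_def param_inv_def s_def[symmetric] s(2)
    by (cases a) (simp add: divide_simps, simp add: power2_eq_square s(3) algebra_simps)
qed

lemma bij_param_map:
  assumes "\<mu> > 0"
  shows "bij (param_map \<mu>)" "inv (param_map \<mu>) = param_inv \<mu>"
proof -
  show "bij (param_map \<mu>)"
    by (rule bij_betw_byWitness[of _ "param_inv \<mu>"]) (simp_all add: param_map_inverse assms)
  show "inv (param_map \<mu>) = param_inv \<mu>"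
    by (rule inv_equality) (simp_all add: param_map_inverse assms)
qed

lemma har_param_map:
  assumes "\<mu> > 0"
  shows "har \<mu> k (param_map \<mu> (\<alpha>p, \<beta>p, \<alpha>m, \<beta>m, \<alpha>0, \<beta>0))
    = Belt_plus \<mu> k \<alpha>p \<beta>p + Belt_minus \<mu> k \<alpha>m \<beta>m + clos \<mu> k \<alpha>0 \<beta>0"
proof -
  have *: "1 / \<mu> * (x - \<mu>\<^sup>2 * y) = 1 / \<mu> * x - \<mu> * y" "1 / \<mu> * (x + \<mu>\<^sup>2 * y) = 1 / \<mu> * x + \<mu> * y"
    for x y
    using assms by (simp_all add: field_simps power2_eq_square)
  \<comment> \<open>As opaque constants, t and u hide every remaining division and root, so the
    components agree by ring arithmetic.\<close>
  define t u where "t = sqrt (\<mu>\<^sup>2 + 1) / \<mu>" and "u = 1 / \<mu>"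
  show ?thesis
    unfolding har_def param_map_def Belt_plus_def Belt_minus_def clos_def prod.case axisym_add
      add_Pair add_0_right *
    unfolding t_def[symmetric] u_def[symmetric]
    by (intro arg_cong2[where f = Pair] axisym_cong) (simp_all add: algebra_simps)
qed

text \<open>The signs and zeros of the eigenvalues sit in the arguments, leaving one common scalar.
  Eigenvalue equations then become equalities of parameter vectors.\<close>

lemma curl_coeff_param_map:
  assumes "\<mu> > 0"
  shows "curl_coeff \<mu> k (param_map \<mu> (\<alpha>p, \<beta>p, \<alpha>m, \<beta>m, \<alpha>0, \<beta>0))
    = varpi \<mu> k *\<^sub>R param_map \<mu> (\<alpha>p, \<beta>p, - \<alpha>m, - \<beta>m, 0, 0)"
proof -
  define s where "s = sqrt (\<mu>\<^sup>2 + 1)"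
  have s: "s * s = \<mu> * \<mu> + 1" "\<And>x. s * (s * x) = (\<mu> * \<mu> + 1) * x"
    by (simp_all add: s_def flip: power2_eq_square mult.assoc)
  show ?thesis
    using assms unfolding curl_coeff_def param_map_def varpi_def s_def[symmetric] Let_def
    by (simp add: divide_simps, simp add: power2_eq_square s algebra_simps)
qed

text \<open>The target need not be finite-dimensional, as is the case for \<open>form1\<close>: the
  image of \<open>Basis\<close> is independent and spans the range, and its cardinality gives the
  dimension.\<close>

lemma dim_range_inj_linear:
  fixes f :: "'a::euclidean_space \<Rightarrow> 'b::real_vector"
  assumes "linear f" "inj f"
  shows "dim (range f) = DIM('a)"
proof -
  have "independent (f ` Basis)"
    by (rule linear_independent_injective_image[OF assms(1) independent_Basis])
      (use assms in \<open>auto intro: inj_on_subset\<close>)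
  moreover have "range f = span (f ` Basis)"
    using linear_span_image[OF assms(1), of Basis] by simp
  ultimately have "dim (range f) = card (f ` Basis)"
    by (metis dim_span dim_eq_card_independent)
  also have "\<dots> = DIM('a)"
    by (rule card_image) (use assms in \<open>auto intro: inj_on_subset\<close>)
  finally show ?thesis .
qed

theorem mainTheorem1:
  fixes \<mu> :: real and k :: nat
  assumes "\<mu> > 0" and "k \<ge> 1"
  shows "(\<forall>a. laplacian1 (har \<mu> k a) = (- (varpi \<mu> k)\<^sup>2) *\<^sub>R har \<mu> k a)
    \<and> (\<forall>\<alpha>p \<beta>p. star_d (Belt_plus \<mu> k \<alpha>p \<beta>p) = varpi \<mu> k *\<^sub>R Belt_plus \<mu> k \<alpha>p \<beta>p)
    \<and> (\<forall>\<alpha>m \<beta>m. star_d (Belt_minus \<mu> k \<alpha>m \<beta>m) = (- varpi \<mu> k) *\<^sub>R Belt_minus \<mu> k \<alpha>m \<beta>m)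
    \<and> (\<forall>\<alpha>0 \<beta>0. ext_d1 (clos \<mu> k \<alpha>0 \<beta>0) = 0)
    \<and> dim (Harm \<mu> k) = 6
    \<and> is_direct_sum3 (Harm \<mu> k)
        (Beltrami_space \<mu> k) (anti_Beltrami_space \<mu> k) (closed_space \<mu> k)
    \<and> dim (Beltrami_space \<mu> k) = 2
    \<and> dim (anti_Beltrami_space \<mu> k) = 2
    \<and> dim (closed_space \<mu> k) = 2
    \<and> Beltrami_space \<mu> k = {Belt_plus \<mu> k \<alpha>p \<beta>p | \<alpha>p \<beta>p. True}
    \<and> anti_Beltrami_space \<mu> k = {Belt_minus \<mu> k \<alpha>m \<beta>m | \<alpha>m \<beta>m. True}
    \<and> closed_space \<mu> k = {clos \<mu> k \<alpha>0 \<beta>0 | \<alpha>0 \<beta>0. True}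
    \<and> (\<forall>\<alpha>p \<beta>p \<alpha>m \<beta>m \<alpha>0 \<beta>0.
          har \<mu> k (param_map \<mu> (\<alpha>p, \<beta>p, \<alpha>m, \<beta>m, \<alpha>0, \<beta>0))
            = Belt_plus \<mu> k \<alpha>p \<beta>p + Belt_minus \<mu> k \<alpha>m \<beta>m + clos \<mu> k \<alpha>0 \<beta>0)
    \<and> linear (param_map \<mu>)
    \<and> bij (param_map \<mu>)
    \<and> inv (param_map \<mu>) = param_inv \<mu>"
proof -
  have k: "k > 0" using assms by simp
  \<comment> \<open>\<open>F\<close> gives linear coordinates on \<open>Harm\<close> in which the
    curl is diagonal; every remaining claim is read off from its injectivity.\<close>
  define F where "F = har \<mu> k \<circ> param_map \<mu>"
  have F_eq: "F (\<alpha>p, \<beta>p, \<alpha>m, \<beta>m, \<alpha>0, \<beta>0)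
      = Belt_plus \<mu> k \<alpha>p \<beta>p + Belt_minus \<mu> k \<alpha>m \<beta>m + clos \<mu> k \<alpha>0 \<beta>0" for \<alpha>p \<beta>p \<alpha>m \<beta>m \<alpha>0 \<beta>0
    using har_param_map[OF assms(1)] by (simp add: F_def)
  have lin: "linear F"
    unfolding F_def by (rule linear_compose[OF linear_param_map linear_har])
  have inj: "inj F"
    unfolding F_def using inj_har[OF assms(1) k] bij_param_map(1)[OF assms(1)]
    by (intro inj_compose) (auto simp: bij_def)
  have F_inj: "F p = F p' \<longleftrightarrow> p = p'" for p p'
    using inj by (auto dest: injD)
  have F_eq_0: "F (\<alpha>p, \<beta>p, \<alpha>m, \<beta>m, \<alpha>0, \<beta>0) = 0 \<longleftrightarrow>
      \<alpha>p = 0 \<and> \<beta>p = 0 \<and> \<alpha>m = 0 \<and> \<beta>m = 0 \<and> \<alpha>0 = 0 \<and> \<beta>0 = 0" for \<alpha>p \<beta>p \<alpha>m \<beta>m \<alpha>0 \<beta>0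
    using F_inj[of _ 0] by (simp add: linear_0[OF lin]) (simp add: zero_prod_def)
  have H: "Harm \<mu> k = range F"
    unfolding Harm_def F_def image_comp[symmetric] bij_is_surj[OF bij_param_map(1)[OF assms(1)]] ..
  have w: "varpi \<mu> k > 0"
    using assms by (simp add: varpi_def add_nonneg_pos)
  have curl: "star_d (F (\<alpha>p, \<beta>p, \<alpha>m, \<beta>m, \<alpha>0, \<beta>0)) = varpi \<mu> k *\<^sub>R F (\<alpha>p, \<beta>p, - \<alpha>m, - \<beta>m, 0, 0)"
    for \<alpha>p \<beta>p \<alpha>m \<beta>m \<alpha>0 \<beta>0
    using assms k by (simp add: F_def star_d_har curl_coeff_param_map linear_scale[OF linear_har])

  have zero: "Belt_plus \<mu> k 0 0 = 0" "Belt_minus \<mu> k 0 0 = 0" "clos \<mu> k 0 0 = 0"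
    by (simp_all add: Belt_plus_def Belt_minus_def clos_def axisym_zero zero_prod_def)
  have P: "Belt_plus \<mu> k \<alpha> \<beta> = F (\<alpha>, \<beta>, 0, 0, 0, 0)" for \<alpha> \<beta>
    by (simp add: F_eq zero)
  have M: "Belt_minus \<mu> k \<alpha> \<beta> = F (0, 0, \<alpha>, \<beta>, 0, 0)" for \<alpha> \<beta>
    by (simp add: F_eq zero)
  have C: "clos \<mu> k \<alpha> \<beta> = F (0, 0, 0, 0, \<alpha>, \<beta>)" for \<alpha> \<beta>
    by (simp add: F_eq zero)

  \<comment> \<open>After cancelling \<open>varpi\<close> > 0, injectivity of \<open>F\<close>
    compares parameters: the minus pair equals its own negative and the closed pair is 0.\<close>
  have eigP: "Beltrami_space \<mu> k = {Belt_plus \<mu> k \<alpha>p \<beta>p | \<alpha>p \<beta>p. True}"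
    using w by (auto simp: Beltrami_space_def H P curl F_inj)
  have eigM: "anti_Beltrami_space \<mu> k = {Belt_minus \<mu> k \<alpha>m \<beta>m | \<alpha>m \<beta>m. True}"
    \<comment> \<open>The negative eigenvalue is absorbed into the argument, -w F(p) = w F(-p), so
      that w cancels again.\<close>
    using w by (auto simp: anti_Beltrami_space_def H M curl F_inj simp flip: scaleR_minus_right linear_neg[OF lin])
  have eigC: "closed_space \<mu> k = {clos \<mu> k \<alpha>0 \<beta>0 | \<alpha>0 \<beta>0. True}"
    using w unfolding closed_space_def star_d_eq_0_iff[symmetric]
    by (auto simp: H C curl F_eq_0 F_inj)

  \<comment> \<open>Embeddings of the three coordinate planes. Each eigenspace is the injective
    linear image of a plane, which gives both the subspace property and dimension 2.\<close>
  define IP :: "real \<times> real \<Rightarrow> real6" where "IP = (\<lambda>(\<alpha>, \<beta>). (\<alpha>, \<beta>, 0, 0, 0, 0))"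
  define IM :: "real \<times> real \<Rightarrow> real6" where "IM = (\<lambda>(\<alpha>, \<beta>). (0, 0, \<alpha>, \<beta>, 0, 0))"
  define IC :: "real \<times> real \<Rightarrow> real6" where "IC = (\<lambda>(\<alpha>, \<beta>). (0, 0, 0, 0, \<alpha>, \<beta>))"
  have I: "linear IP" "linear IM" "linear IC" "inj IP" "inj IM" "inj IC"
    by (auto intro!: linearI injI simp: IP_def IM_def IC_def)
  have FI: "linear (F \<circ> IP)" "linear (F \<circ> IM)" "linear (F \<circ> IC)"
     "inj (F \<circ> IP)" "inj (F \<circ> IM)" "inj (F \<circ> IC)"
    using I by (auto intro: linear_compose lin inj_compose inj)
  have range: "Beltrami_space \<mu> k = range (F \<circ> IP)" "anti_Beltrami_space \<mu> k = range (F \<circ> IM)"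
    "closed_space \<mu> k = range (F \<circ> IC)"
    unfolding eigP eigM eigC by (auto simp: P M C IP_def IM_def IC_def image_iff F_inj)

  have "bij_betw (\<lambda>(a, b, c). a + b + c) (Beltrami_space \<mu> k \<times> anti_Beltrami_space \<mu> k \<times> closed_space \<mu> k)
      (Harm \<mu> k)"
    unfolding bij_betw_def eigP eigM eigC
  proof
    show "inj_on (\<lambda>(a, b, c). a + b + c) ({Belt_plus \<mu> k \<alpha>p \<beta>p | \<alpha>p \<beta>p. True}
        \<times> {Belt_minus \<mu> k \<alpha>m \<beta>m | \<alpha>m \<beta>m. True} \<times> {clos \<mu> k \<alpha>0 \<beta>0 | \<alpha>0 \<beta>0. True})"
      \<comment> \<open>Folding \<open>F_eq\<close> turns a sum of three summands into one value of
        \<open>F\<close>, whose injectivity gives uniqueness of the decomposition.\<close>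
      by (rule inj_onI, clarify) (simp add: F_inj flip: F_eq)
    show "(\<lambda>(a, b, c). a + b + c) ` ({Belt_plus \<mu> k \<alpha>p \<beta>p | \<alpha>p \<beta>p. True}
        \<times> {Belt_minus \<mu> k \<alpha>m \<beta>m | \<alpha>m \<beta>m. True} \<times> {clos \<mu> k \<alpha>0 \<beta>0 | \<alpha>0 \<beta>0. True}) = Harm \<mu> k"
      (is "?L = _")
    proof
      show "?L \<subseteq> Harm \<mu> k"
        unfolding H by clarify (simp flip: F_eq)
      show "Harm \<mu> k \<subseteq> ?L"
      proof
        fix \<omega> assume "\<omega> \<in> Harm \<mu> k"
        then obtain \<alpha>p \<beta>p \<alpha>m \<beta>m \<alpha>0 \<beta>0
          where "\<omega> = F (\<alpha>p, \<beta>p, \<alpha>m, \<beta>m, \<alpha>0, \<beta>0)"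
          unfolding H by (metis imageE prod.exhaust)
        then show "\<omega> \<in> ?L"
          unfolding F_eq
          by (intro image_eqI[of _ _ "(Belt_plus \<mu> k \<alpha>p \<beta>p, Belt_minus \<mu> k \<alpha>m \<beta>m, clos \<mu> k \<alpha>0 \<beta>0)"]) auto
      qed
    qed
  qed
  moreover have "subspace (Harm \<mu> k)" "subspace (Beltrami_space \<mu> k)"
    "subspace (anti_Beltrami_space \<mu> k)" "subspace (closed_space \<mu> k)"
    unfolding range H by (intro linear_subspace_image[OF _ subspace_UNIV] lin FI)+
  ultimately have sum: "is_direct_sum3 (Harm \<mu> k)
      (Beltrami_space \<mu> k) (anti_Beltrami_space \<mu> k) (closed_space \<mu> k)"
    unfolding is_direct_sum3_def by (intro conjI)

  have curlP: "star_d (Belt_plus \<mu> k \<alpha> \<beta>) = varpi \<mu> k *\<^sub>R Belt_plus \<mu> k \<alpha> \<beta>" for \<alpha> \<beta>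
    by (simp add: P curl)
  have curlM: "star_d (Belt_minus \<mu> k \<alpha> \<beta>) = (- varpi \<mu> k) *\<^sub>R Belt_minus \<mu> k \<alpha> \<beta>" for \<alpha> \<beta>
    using linear_neg[OF lin, of "(0, 0, \<alpha>, \<beta>, 0, 0)"] by (simp add: M curl)
  have curlC: "ext_d1 (clos \<mu> k \<alpha> \<beta>) = 0" for \<alpha> \<beta>
    by (simp add: C curl F_eq_0 flip: star_d_eq_0_iff)
  have dims: "dim (Harm \<mu> k) = 6" "dim (Beltrami_space \<mu> k) = 2"
    "dim (anti_Beltrami_space \<mu> k) = 2" "dim (closed_space \<mu> k) = 2"
    unfolding H range using lin inj FI by (simp_all only: dim_range_inj_linear) simp_all
  show ?thesis
    by (intro conjI allI; fact laplacian1_har[OF assms(1) k] curlP curlM curlC dims sum eigP eigM eigC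
        har_param_map[OF assms(1)] linear_param_map bij_param_map[OF assms(1)])
qed

end
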